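(* Let $\Sigma$ be a set and $\Sigma_\tau=\Sigma+\{\tau\}$. The monad $\mathcal{CM}(\Sigma_\tau\times\mathcal{I}d)$ on $\mathsf{Set}$ (described in the context) is an ordered saturation monad.
   Context: $\mathcal{M}X$: finitely supported $\phi:X\to[0,\infty)$, written $\sum_x\phi(x)\cdot x$; $\mathcal{CM}X$: non-empty convex subsets of $\mathcal{M}X$ (closed under $\sum a_i\phi_i$, $a_i\ge0$, $\sum a_i=1$); $\mathcal{CM}f(U)=\{\mathcal{M}f(\phi)\mid\phi\in U\}$. For $\sigma\in\Sigma_\tau$ and $\psi\in\mathcal{M}(\Sigma_\tau\times Z)$ let $\rho_\tau(\psi)=\psi$ and, for $\sigma\ne\tau$, $\rho_\sigma(\psi)=\sum_z\psi(\tau,z)\cdot(\sigma,z)$. The monad $\mathcal{CM}(\Sigma_\tau\times\mathcal{I}d)$ has Kleisli identities $x\mapsto\{1\cdot(\tau,x)\}$ and Kleisli composition of $f:X\to\mathcal{CM}(\Sigma_\tau\times Y)$, $g:Y\to\mathcal{CM}(\Sigma_\tau\times Z)$ given by $g\bullet f(x)=\bigcup_{\phi\in f(x)}\sum_{(\sigma,y)\in\mathrm{supp}(\phi)}\{\phi(\sigma,y)\cdot\rho_\sigma(\psi)\mid\psi\in g(y)\}$ (Minkowski sums, empty sum $\{0\}$); for a map $f:X\to Y$, $f^\sharp(x)=\{1\cdot(\tau,f(x))\}$. Kleisli hom-sets are ordered by pointwise inclusion. Ordered saturation monad: Kleisli hom-sets are posets with monotone composition and for each $\alpha:X\to\mathcal{CM}(\Sigma_\tau\times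 X)$ there is $\alpha^\star$ with (1) $1\le\alpha^\star$; (2) $\alpha\le\alpha^\star$; (3) $\alpha^\star\bullet\alpha^\star\le\alpha^\star$; (4) $\alpha^\star\le\beta$ whenever $1\le\beta$, $\alpha\le\beta$, $\beta\bullet\beta\le\beta$; (5) for any map $f:X\to Y$ and $\beta:Y\to\mathcal{CM}(\Sigma_\tau\times Y)$, $f^\sharp\bullet\alpha\le\beta\bullet f^\sharp\Rightarrow f^\sharp\bullet\alpha^\star\le\beta^\star\bullet f^\sharp$, and likewise with $\ge$. *)

theory Defs
  imports Complex_Main "HOL-Library.FuncSet" "HOL-Library.Function_Algebras" "HOL-Library.Set_Algebras"
begin

(* Monads are presented as Kleisli triples. Objects are the subsets of an arbitrary type 'u rather
   than types, so that the empty set is an object and objects can be quantified over.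
   Kleisli maps are extensional functions, hence equality of maps is equality on the domain. *)

locale kleisli_triple =
  fixes T :: "'u set \<Rightarrow> 't set"
    and unit :: "'u set \<Rightarrow> 'u \<Rightarrow> 't"
    and ext :: "'u set \<Rightarrow> 'u set \<Rightarrow> ('u \<Rightarrow> 't) \<Rightarrow> 't \<Rightarrow> 't"
  assumes unit_in: "x \<in> X \<Longrightarrow> unit X x \<in> T X"
    and ext_in: "f \<in> X \<rightarrow>\<^sub>E T Y \<Longrightarrow> t \<in> T X \<Longrightarrow> ext X Y f t \<in> T Y"
    and ext_unit: "t \<in> T X \<Longrightarrow> ext X X (\<lambda>x\<in>X. unit X x) t = t"
    and ext_apply_unit: "f \<in> X \<rightarrow>\<^sub>E T Y \<Longrightarrow> x \<in> X \<Longrightarrow> ext X Y f (unit X x) = f x"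
    and ext_ext: "f \<in> X \<rightarrow>\<^sub>E T Y \<Longrightarrow> g \<in> Y \<rightarrow>\<^sub>E T Z \<Longrightarrow> t \<in> T X \<Longrightarrow>
      ext Y Z g (ext X Y f t) = ext X Z (\<lambda>x\<in>X. ext Y Z g (f x)) t"
begin

definition hom :: "'u set \<Rightarrow> 'u set \<Rightarrow> ('u \<Rightarrow> 't) set" where
  "hom X Y = X \<rightarrow>\<^sub>E T Y"

definition kid :: "'u set \<Rightarrow> 'u \<Rightarrow> 't" where
  "kid X = (\<lambda>x\<in>X. unit X x)"

definition kcomp :: "'u set \<Rightarrow> 'u set \<Rightarrow> 'u set \<Rightarrow> ('u \<Rightarrow> 't) \<Rightarrow> ('u \<Rightarrow> 't) \<Rightarrow> 'u \<Rightarrow> 't" where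
  "kcomp X Y Z g f = (\<lambda>x\<in>X. ext Y Z g (f x))"

definition sharp :: "'u set \<Rightarrow> 'u set \<Rightarrow> ('u \<Rightarrow> 'u) \<Rightarrow> 'u \<Rightarrow> 't" where
  "sharp X Y f = (\<lambda>x\<in>X. unit Y (f x))"

end

locale ordered_saturation_monad = kleisli_triple T unit ext
  for T :: "'u set \<Rightarrow> 't set"
    and unit :: "'u set \<Rightarrow> 'u \<Rightarrow> 't"
    and ext :: "'u set \<Rightarrow> 'u set \<Rightarrow> ('u \<Rightarrow> 't) \<Rightarrow> 't \<Rightarrow> 't" +
  fixes le :: "'u set \<Rightarrow> 'u set \<Rightarrow> ('u \<Rightarrow> 't) \<Rightarrow> ('u \<Rightarrow> 't) \<Rightarrow> bool"
  assumes le_refl: "reflp_on (hom X Y) (le X Y)"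
    and le_antisym: "antisymp_on (hom X Y) (le X Y)"
    and le_trans: "transp_on (hom X Y) (le X Y)"
    and kcomp_mono: "f \<in> hom X Y \<Longrightarrow> f' \<in> hom X Y \<Longrightarrow> g \<in> hom Y Z \<Longrightarrow> g' \<in> hom Y Z \<Longrightarrow>
      le X Y f f' \<Longrightarrow> le Y Z g g' \<Longrightarrow> le X Z (kcomp X Y Z g f) (kcomp X Y Z g' f')"
    and saturation: "\<exists>star :: 'u set \<Rightarrow> ('u \<Rightarrow> 't) \<Rightarrow> 'u \<Rightarrow> 't.
      (\<forall>X. \<forall>\<alpha> \<in> hom X X.
         star X \<alpha> \<in> hom X X \<and>
         le X X (kid X) (star X \<alpha>) \<and>
         le X X \<alpha> (star X \<alpha>) \<and>
         le X X (kcomp X X X (star X \<alpha>) (star X \<alpha>)) (star X \<alpha>) \<and>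
         (\<forall>\<beta> \<in> hom X X. le X X (kid X) \<beta> \<longrightarrow> le X X \<alpha> \<beta> \<longrightarrow> le X X (kcomp X X X \<beta> \<beta>) \<beta> \<longrightarrow>
            le X X (star X \<alpha>) \<beta>)) \<and>
      (\<forall>X Y. \<forall>\<alpha> \<in> hom X X. \<forall>\<beta> \<in> hom Y Y. \<forall>f \<in> X \<rightarrow> Y.
         (le X Y (kcomp X X Y (sharp X Y f) \<alpha>) (kcomp X Y Y \<beta> (sharp X Y f)) \<longrightarrow>
          le X Y (kcomp X X Y (sharp X Y f) (star X \<alpha>)) (kcomp X Y Y (star Y \<beta>) (sharp X Y f))) \<and>
         (le X Y (kcomp X Y Y \<beta> (sharp X Y f)) (kcomp X X Y (sharp X Y f) \<alpha>) \<longrightarrow>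
          le X Y (kcomp X Y Y (star Y \<beta>) (sharp X Y f)) (kcomp X X Y (sharp X Y f) (star X \<alpha>))))"

definition supp :: "('a \<Rightarrow> real) \<Rightarrow> 'a set" where
  "supp \<phi> = {x. \<phi> x \<noteq> 0}"

definition \<M> :: "'a set \<Rightarrow> ('a \<Rightarrow> real) set" where
  "\<M> X = {\<phi>. (\<forall>x. 0 \<le> \<phi> x) \<and> finite (supp \<phi>) \<and> supp \<phi> \<subseteq> X}"

definition scale :: "real \<Rightarrow> ('a \<Rightarrow> real) \<Rightarrow> 'a \<Rightarrow> real" where
  "scale a \<phi> = (\<lambda>x. a * \<phi> x)"

definition single :: "'a \<Rightarrow> 'a \<Rightarrow> real" where
  "single x = (\<lambda>y. if y = x then 1 else 0)"

definition convex_set :: "('a \<Rightarrow> real) set \<Rightarrow> bool" where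
  "convex_set U \<longleftrightarrow> (\<forall>(n::nat) a \<phi>.
     (\<forall>i<n. 0 \<le> a i \<and> \<phi> i \<in> U) \<longrightarrow> (\<Sum>i<n. a i) = 1 \<longrightarrow> (\<Sum>i<n. scale (a i) (\<phi> i)) \<in> U)"

definition \<C>\<M> :: "'a set \<Rightarrow> ('a \<Rightarrow> real) set set" where
  "\<C>\<M> X = {U. U \<noteq> {} \<and> U \<subseteq> \<M> X \<and> convex_set U}"

(* The silent label tau is None. *)
definition labels :: "'s set \<Rightarrow> 's option set" where
  "labels \<Sigma> = insert None (Some ` \<Sigma>)"

definition \<rho> :: "'s option \<Rightarrow> ('s option \<times> 'z \<Rightarrow> real) \<Rightarrow> 's option \<times> 'z \<Rightarrow> real" where
  "\<rho> \<sigma> \<psi> = (if \<sigma> = None then \<psi> else (\<lambda>(\<sigma>', z). if \<sigma>' = \<sigma> then \<psi> (None, z) else 0))"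

definition cm_unit :: "'x \<Rightarrow> ('s option \<times> 'x \<Rightarrow> real) set" where
  "cm_unit x = {single (None, x)}"

(* The sum is the Minkowski sum of sets (Set_Algebras) of functions (Function_Algebras);
   the empty sum is {0}. *)
definition cm_ext :: "('y \<Rightarrow> ('s option \<times> 'z \<Rightarrow> real) set) \<Rightarrow>
    ('s option \<times> 'y \<Rightarrow> real) set \<Rightarrow> ('s option \<times> 'z \<Rightarrow> real) set" where
  "cm_ext g U = (\<Union>\<phi>\<in>U. \<Sum>(\<sigma>, y)\<in>supp \<phi>. {scale (\<phi> (\<sigma>, y)) (\<rho> \<sigma> \<psi>) | \<psi>. \<psi> \<in> g y})"

end

theory Submission
  imports Defs
begin

text \<open>
  The saturation \<open>\<alpha>\<^sup>\<star>\<close> is the infimum of all \<open>\<beta> \<ge> \<alpha>\<close> with \<open>1 \<le> \<beta>\<close> and \<open>\<beta> \<bullet> \<beta> \<le> \<beta>\<close>.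
  Condition (5) needs no description of its elements. By residuation there is a largest \<open>\<gamma>\<close> with
  \<open>f\<^sup>\<sharp> \<bullet> \<gamma> \<le> \<beta>\<^sup>\<star> \<bullet> f\<^sup>\<sharp>\<close>; it is one of the maps of which \<open>\<alpha>\<^sup>\<star>\<close> is the infimum, because
  \<open>f\<^sup>\<sharp> \<bullet> \<gamma> \<bullet> \<gamma> \<le> \<beta>\<^sup>\<star> \<bullet> f\<^sup>\<sharp> \<bullet> \<gamma> \<le> \<beta>\<^sup>\<star> \<bullet> \<beta>\<^sup>\<star> \<bullet> f\<^sup>\<sharp> \<le> \<beta>\<^sup>\<star> \<bullet> f\<^sup>\<sharp>\<close>. The reverse inequality is dual.

  That \<open>\<C>\<M>\<close> is a monad rests on convexity: in the associativity law one side chooses a single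
  continuation per intermediate point, the other one for every way of reaching it, and averaging
  the latter by Bayes' rule stays inside the convex sets of continuations. Labels are then added
  formally, since \<open>\<rho>\<^sub>\<sigma>\<close> is linear.
\<close>

section \<open>Saturation by residuation\<close>

context kleisli_triple
begin

lemma kid_in_hom: "kid X \<in> hom X X"
  by (simp add: hom_def kid_def unit_in)

lemma sharp_in_hom: "f \<in> X \<rightarrow> Y \<Longrightarrow> sharp X Y f \<in> hom X Y"
  by (auto simp: hom_def sharp_def intro: unit_in)

lemma kcomp_in_hom: "f \<in> hom X Y \<Longrightarrow> g \<in> hom Y Z \<Longrightarrow> kcomp X Y Z g f \<in> hom X Z"
  by (auto simp: hom_def kcomp_def intro: ext_in)

lemma kcomp_kid_left:
  assumes "f \<in> hom X Y"
  shows "kcomp X Y Y (kid Y) f = f"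
proof (rule PiE_ext)
  show "kcomp X Y Y (kid Y) f \<in> X \<rightarrow>\<^sub>E T Y" "f \<in> X \<rightarrow>\<^sub>E T Y"
    using kcomp_in_hom[OF assms kid_in_hom] assms by (simp_all add: hom_def)
  show "kcomp X Y Y (kid Y) f x = f x" if "x \<in> X" for x
    using that assms ext_unit[of "f x" Y] by (auto simp: hom_def kcomp_def kid_def)
qed

lemma kcomp_sharp_apply:
  "g \<in> hom Y Z \<Longrightarrow> f \<in> X \<rightarrow> Y \<Longrightarrow> x \<in> X \<Longrightarrow> kcomp X Y Z g (sharp X Y f) x = g (f x)"
  using ext_apply_unit[of g Y Z "f x"] by (auto simp: hom_def kcomp_def sharp_def)

lemma kcomp_kid_right:
  assumes "f \<in> hom X Y"
  shows "kcomp X X Y f (kid X) = f"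
proof (rule PiE_ext)
  show "kcomp X X Y f (kid X) \<in> X \<rightarrow>\<^sub>E T Y" "f \<in> X \<rightarrow>\<^sub>E T Y"
    using kcomp_in_hom[OF kid_in_hom assms] assms by (simp_all add: hom_def)
  show "kcomp X X Y f (kid X) x = f x" if "x \<in> X" for x
    using that assms by (auto simp: hom_def kcomp_def kid_def ext_apply_unit)
qed

lemma kcomp_assoc:
  assumes "f \<in> hom W X" "g \<in> hom X Y" "h \<in> hom Y Z"
  shows "kcomp W Y Z h (kcomp W X Y g f) = kcomp W X Z (kcomp X Y Z h g) f"
proof (rule PiE_ext)
  show "kcomp W Y Z h (kcomp W X Y g f) \<in> W \<rightarrow>\<^sub>E T Z"
    "kcomp W X Z (kcomp X Y Z h g) f \<in> W \<rightarrow>\<^sub>E T Z"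
    using assms by (simp_all add: kcomp_in_hom flip: hom_def)
  show "kcomp W Y Z h (kcomp W X Y g f) x = kcomp W X Z (kcomp X Y Z h g) f x" if "x \<in> W" for x
    using that assms ext_ext[of g X Y h Z "f x"] by (auto simp: hom_def kcomp_def)
qed

end

locale ordered_kleisli_triple = kleisli_triple T unit ext
  for T :: "'u set \<Rightarrow> 't set"
    and unit :: "'u set \<Rightarrow> 'u \<Rightarrow> 't"
    and ext :: "'u set \<Rightarrow> 'u set \<Rightarrow> ('u \<Rightarrow> 't) \<Rightarrow> 't \<Rightarrow> 't" +
  fixes le :: "'u set \<Rightarrow> 'u set \<Rightarrow> ('u \<Rightarrow> 't) \<Rightarrow> ('u \<Rightarrow> 't) \<Rightarrow> bool"
  assumes le_refl: "reflp_on (hom X Y) (le X Y)"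
    and le_antisym: "antisymp_on (hom X Y) (le X Y)"
    and le_trans: "transp_on (hom X Y) (le X Y)"
    and kcomp_mono: "f \<in> hom X Y \<Longrightarrow> f' \<in> hom X Y \<Longrightarrow> g \<in> hom Y Z \<Longrightarrow> g' \<in> hom Y Z \<Longrightarrow>
      le X Y f f' \<Longrightarrow> le Y Z g g' \<Longrightarrow> le X Z (kcomp X Y Z g f) (kcomp X Y Z g' f')"
begin

definition hom_le :: "'u set \<Rightarrow> 'u set \<Rightarrow> ('u \<Rightarrow> 't) \<Rightarrow> ('u \<Rightarrow> 't) \<Rightarrow> bool" where
  "hom_le X Y f g \<longleftrightarrow> f \<in> hom X Y \<and> g \<in> hom X Y \<and> le X Y f g"

lemma hom_leD:
  assumes "hom_le X Y f g"
  shows "f \<in> hom X Y" "g \<in> hom X Y" "le X Y f g"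
  using assms by (auto simp: hom_le_def)

lemma hom_le_refl: "f \<in> hom X Y \<Longrightarrow> hom_le X Y f f"
  using le_refl by (simp add: hom_le_def reflp_on_def)

lemma hom_le_trans [trans]: "hom_le X Y f g \<Longrightarrow> hom_le X Y g h \<Longrightarrow> hom_le X Y f h"
  using le_trans unfolding hom_le_def transp_on_def by blast

lemma kcomp_hom_le:
  "hom_le X Y f f' \<Longrightarrow> hom_le Y Z g g' \<Longrightarrow> hom_le X Z (kcomp X Y Z g f) (kcomp X Y Z g' f')"
  by (simp add: hom_le_def kcomp_in_hom kcomp_mono)

definition saturated :: "'u set \<Rightarrow> ('u \<Rightarrow> 't) \<Rightarrow> bool" where
  "saturated X \<beta> \<longleftrightarrow> hom_le X X (kid X) \<beta> \<and> hom_le X X (kcomp X X X \<beta> \<beta>) \<beta>"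

lemma saturatedD:
  assumes "saturated X \<beta>"
  shows "\<beta> \<in> hom X X" "hom_le X X (kid X) \<beta>" "hom_le X X (kcomp X X X \<beta> \<beta>) \<beta>"
  using assms by (auto simp: saturated_def dest: hom_leD)

definition is_saturation :: "'u set \<Rightarrow> ('u \<Rightarrow> 't) \<Rightarrow> ('u \<Rightarrow> 't) \<Rightarrow> bool" where
  "is_saturation X \<alpha> \<sigma> \<longleftrightarrow> saturated X \<sigma> \<and> hom_le X X \<alpha> \<sigma> \<and>
     (\<forall>\<beta>. saturated X \<beta> \<longrightarrow> hom_le X X \<alpha> \<beta> \<longrightarrow> hom_le X X \<sigma> \<beta>)"

lemma is_saturationD:
  assumes "is_saturation X \<alpha> \<sigma>"
  shows "saturated X \<sigma>" "hom_le X X \<alpha> \<sigma>"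
    and "saturated X \<beta> \<Longrightarrow> hom_le X X \<alpha> \<beta> \<Longrightarrow> hom_le X X \<sigma> \<beta>"
  using assms by (auto simp: is_saturation_def)

end

text \<open>The values of Kleisli maps will be non-empty sets. Therefore infima are only required of
  families that are bounded below, and residuals only where the identity satisfies the defining
  inequality.\<close>

locale residuated_kleisli_triple = ordered_kleisli_triple T unit ext le
  for T :: "'u set \<Rightarrow> 't set"
    and unit :: "'u set \<Rightarrow> 'u \<Rightarrow> 't"
    and ext :: "'u set \<Rightarrow> 'u set \<Rightarrow> ('u \<Rightarrow> 't) \<Rightarrow> 't \<Rightarrow> 't"
    and le :: "'u set \<Rightarrow> 'u set \<Rightarrow> ('u \<Rightarrow> 't) \<Rightarrow> ('u \<Rightarrow> 't) \<Rightarrow> bool" +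
  assumes ex_infimum: "\<lbrakk>B \<subseteq> hom X Y; \<kappa> \<in> hom X Y; \<And>\<beta>. \<beta> \<in> B \<Longrightarrow> le X Y \<kappa> \<beta>\<rbrakk> \<Longrightarrow>
      \<exists>\<mu>\<in>hom X Y. \<forall>\<gamma>\<in>hom X Y. le X Y \<gamma> \<mu> \<longleftrightarrow> (\<forall>\<beta>\<in>B. le X Y \<gamma> \<beta>)"
    and ex_sharp_post_residual: "\<lbrakk>f \<in> X \<rightarrow> Y; \<eta> \<in> hom X Y; le X Y (sharp X Y f) \<eta>\<rbrakk> \<Longrightarrow>
      \<exists>\<gamma>\<in>hom X X. \<forall>\<alpha>\<in>hom X X. le X X \<alpha> \<gamma> \<longleftrightarrow> le X Y (kcomp X X Y (sharp X Y f) \<alpha>) \<eta>"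
    and ex_sharp_pre_residual: "\<lbrakk>f \<in> X \<rightarrow> Y; \<eta> \<in> hom X Y; le X Y (sharp X Y f) \<eta>\<rbrakk> \<Longrightarrow>
      \<exists>\<delta>\<in>hom Y Y. \<forall>\<beta>\<in>hom Y Y. le Y Y \<beta> \<delta> \<longleftrightarrow> le X Y (kcomp X Y Y \<beta> (sharp X Y f)) \<eta>"
begin

lemma ex_saturation:
  assumes \<alpha>: "\<alpha> \<in> hom X X"
  shows "\<exists>\<sigma>. is_saturation X \<alpha> \<sigma>"
proof -
  define B where "B = {\<beta>. saturated X \<beta> \<and> hom_le X X \<alpha> \<beta>}"
  have "B \<subseteq> hom X X" "\<And>\<beta>. \<beta> \<in> B \<Longrightarrow> le X X \<alpha> \<beta>"
    by (auto simp: B_def hom_le_def)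
  then obtain \<mu> where \<mu>: "\<mu> \<in> hom X X"
      and inf: "\<And>\<gamma>. \<gamma> \<in> hom X X \<Longrightarrow> le X X \<gamma> \<mu> \<longleftrightarrow> (\<forall>\<beta>\<in>B. le X X \<gamma> \<beta>)"
    using ex_infimum[of B X X \<alpha>] \<alpha> by blast
  have greatest: "hom_le X X \<gamma> \<mu>" if "\<gamma> \<in> hom X X" "\<And>\<beta>. \<beta> \<in> B \<Longrightarrow> hom_le X X \<gamma> \<beta>" for \<gamma>
    using that \<mu> inf by (auto simp: hom_le_def)
  have lower: "hom_le X X \<mu> \<beta>" if "\<beta> \<in> B" for \<beta>
    using that \<mu> inf[OF \<mu>] hom_le_refl[OF \<mu>] \<open>B \<subseteq> hom X X\<close> by (auto simp: hom_le_def)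
  have "hom_le X X (kcomp X X X \<mu> \<mu>) \<beta>" if "\<beta> \<in> B" for \<beta>
  proof -
    have "hom_le X X (kcomp X X X \<mu> \<mu>) (kcomp X X X \<beta> \<beta>)"
      using lower[OF that] by (intro kcomp_hom_le)
    also have "hom_le X X (kcomp X X X \<beta> \<beta>) \<beta>"
      using that by (simp add: B_def saturatedD)
    finally show ?thesis .
  qed
  then have "saturated X \<mu>"
    using \<mu> by (auto simp: saturated_def B_def intro!: greatest kid_in_hom kcomp_in_hom)
  moreover have "hom_le X X \<alpha> \<mu>"
    using \<alpha> by (auto simp: B_def intro: greatest)
  ultimately show ?thesis
    using lower by (auto simp: is_saturation_def B_def)
qed

lemma is_saturation_induct:
  assumes \<sigma>: "is_saturation X \<alpha> \<sigma>" and \<gamma>: "\<gamma> \<in> hom X X"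
    and greatest: "\<And>\<xi>. \<xi> \<in> hom X X \<Longrightarrow> hom_le X X \<xi> \<gamma> \<longleftrightarrow> P \<xi>"
    and identity: "P (kid X)" and base: "P \<alpha>" and comp: "P \<gamma> \<Longrightarrow> P (kcomp X X X \<gamma> \<gamma>)"
  shows "P \<sigma>"
proof -
  have "P \<gamma>"
    using greatest[OF \<gamma>] hom_le_refl[OF \<gamma>] by simp
  then have "saturated X \<gamma>"
    using identity comp \<gamma> by (simp add: saturated_def greatest kid_in_hom kcomp_in_hom)
  moreover have "hom_le X X \<alpha> \<gamma>"
    using base greatest hom_leD(1)[OF is_saturationD(2)[OF \<sigma>]] by blast
  ultimately have "hom_le X X \<sigma> \<gamma>"
    by (rule is_saturationD(3)[OF \<sigma>])
  then show ?thesis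
    using greatest hom_leD(1) by blast
qed

lemma kcomp_sharp_saturation_le:
  assumes f: "f \<in> X \<rightarrow> Y" and \<sigma>: "is_saturation X \<alpha> \<sigma>" and \<kappa>: "saturated Y \<kappa>"
    and \<alpha>_le: "hom_le X Y (kcomp X X Y (sharp X Y f) \<alpha>) (kcomp X Y Y \<kappa> (sharp X Y f))"
  shows "hom_le X Y (kcomp X X Y (sharp X Y f) \<sigma>) (kcomp X Y Y \<kappa> (sharp X Y f))"
proof -
  let ?F = "sharp X Y f"
  let ?\<kappa>F = "kcomp X Y Y \<kappa> ?F"
  note F_hom = sharp_in_hom[OF f] and \<kappa>_hom = saturatedD(1)[OF \<kappa>]
  have "hom_le X Y (kcomp X Y Y (kid Y) ?F) ?\<kappa>F"
    using F_hom saturatedD(2)[OF \<kappa>] by (intro kcomp_hom_le hom_le_refl)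
  then have F_le: "hom_le X Y ?F ?\<kappa>F"
    by (simp add: kcomp_kid_left F_hom)
  obtain \<gamma> where \<gamma>: "\<gamma> \<in> hom X X"
    and "\<And>\<xi>. \<xi> \<in> hom X X \<Longrightarrow> le X X \<xi> \<gamma> \<longleftrightarrow> le X Y (kcomp X X Y ?F \<xi>) ?\<kappa>F"
    using ex_sharp_post_residual[OF f hom_leD(2,3)[OF F_le]] by blast
  then have greatest: "hom_le X X \<xi> \<gamma> \<longleftrightarrow> hom_le X Y (kcomp X X Y ?F \<xi>) ?\<kappa>F"
    if "\<xi> \<in> hom X X" for \<xi>
    using that F_hom \<kappa>_hom by (simp add: hom_le_def kcomp_in_hom)
  show ?thesis
  proof (rule is_saturation_induct[OF \<sigma> \<gamma> greatest])
    show "hom_le X Y (kcomp X X Y ?F (kid X)) ?\<kappa>F"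
      using F_le by (simp add: kcomp_kid_right F_hom)
    show "hom_le X Y (kcomp X X Y ?F \<alpha>) ?\<kappa>F"
      by (rule \<alpha>_le)
    assume F\<gamma>_le: "hom_le X Y (kcomp X X Y ?F \<gamma>) ?\<kappa>F"
    have "hom_le X Y (kcomp X X Y ?F (kcomp X X X \<gamma> \<gamma>)) (kcomp X Y Y \<kappa> (kcomp X X Y ?F \<gamma>))"
      using kcomp_hom_le[OF hom_le_refl[OF \<gamma>] F\<gamma>_le]
      by (simp add: kcomp_assoc kcomp_in_hom \<gamma> F_hom \<kappa>_hom)
    also have "hom_le X Y \<dots> (kcomp X Y Y (kcomp Y Y Y \<kappa> \<kappa>) ?F)"
      using kcomp_hom_le[OF F\<gamma>_le hom_le_refl[OF \<kappa>_hom]] by (simp add: kcomp_assoc F_hom \<kappa>_hom)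
    also have "hom_le X Y \<dots> ?\<kappa>F"
      using F_hom saturatedD(3)[OF \<kappa>] by (intro kcomp_hom_le hom_le_refl)
    finally show "hom_le X Y (kcomp X X Y ?F (kcomp X X X \<gamma> \<gamma>)) ?\<kappa>F" .
  qed
qed

lemma saturation_kcomp_sharp_le:
  assumes f: "f \<in> X \<rightarrow> Y" and \<sigma>: "is_saturation Y \<beta> \<sigma>" and \<kappa>: "saturated X \<kappa>"
    and \<beta>_le: "hom_le X Y (kcomp X Y Y \<beta> (sharp X Y f)) (kcomp X X Y (sharp X Y f) \<kappa>)"
  shows "hom_le X Y (kcomp X Y Y \<sigma> (sharp X Y f)) (kcomp X X Y (sharp X Y f) \<kappa>)"
proof -
  let ?F = "sharp X Y f"
  let ?F\<kappa> = "kcomp X X Y ?F \<kappa>"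
  note F_hom = sharp_in_hom[OF f] and \<kappa>_hom = saturatedD(1)[OF \<kappa>]
  have "hom_le X Y (kcomp X X Y ?F (kid X)) ?F\<kappa>"
    using F_hom saturatedD(2)[OF \<kappa>] by (intro kcomp_hom_le hom_le_refl)
  then have F_le: "hom_le X Y ?F ?F\<kappa>"
    by (simp add: kcomp_kid_right F_hom)
  obtain \<delta> where \<delta>: "\<delta> \<in> hom Y Y"
    and "\<And>\<xi>. \<xi> \<in> hom Y Y \<Longrightarrow> le Y Y \<xi> \<delta> \<longleftrightarrow> le X Y (kcomp X Y Y \<xi> ?F) ?F\<kappa>"
    using ex_sharp_pre_residual[OF f hom_leD(2,3)[OF F_le]] by blast
  then have greatest: "hom_le Y Y \<xi> \<delta> \<longleftrightarrow> hom_le X Y (kcomp X Y Y \<xi> ?F) ?F\<kappa>"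
    if "\<xi> \<in> hom Y Y" for \<xi>
    using that F_hom \<kappa>_hom by (simp add: hom_le_def kcomp_in_hom)
  show ?thesis
  proof (rule is_saturation_induct[OF \<sigma> \<delta> greatest])
    show "hom_le X Y (kcomp X Y Y (kid Y) ?F) ?F\<kappa>"
      using F_le by (simp add: kcomp_kid_left F_hom)
    show "hom_le X Y (kcomp X Y Y \<beta> ?F) ?F\<kappa>"
      by (rule \<beta>_le)
    assume \<delta>F_le: "hom_le X Y (kcomp X Y Y \<delta> ?F) ?F\<kappa>"
    have "hom_le X Y (kcomp X Y Y (kcomp Y Y Y \<delta> \<delta>) ?F) (kcomp X X Y (kcomp X Y Y \<delta> ?F) \<kappa>)"
      using kcomp_hom_le[OF \<delta>F_le hom_le_refl[OF \<delta>]] by (simp add: kcomp_assoc \<delta> F_hom \<kappa>_hom)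
    also have "hom_le X Y \<dots> (kcomp X X Y ?F (kcomp X X X \<kappa> \<kappa>))"
      using kcomp_hom_le[OF hom_le_refl[OF \<kappa>_hom] \<delta>F_le] by (simp add: kcomp_assoc F_hom \<kappa>_hom)
    also have "hom_le X Y \<dots> ?F\<kappa>"
      using F_hom saturatedD(3)[OF \<kappa>] by (intro kcomp_hom_le hom_le_refl)
    finally show "hom_le X Y (kcomp X Y Y (kcomp Y Y Y \<delta> \<delta>) ?F) ?F\<kappa>" .
  qed
qed

definition star :: "'u set \<Rightarrow> ('u \<Rightarrow> 't) \<Rightarrow> 'u \<Rightarrow> 't" where
  "star X \<alpha> = (SOME \<sigma>. is_saturation X \<alpha> \<sigma>)"

lemma is_saturation_star: "\<alpha> \<in> hom X X \<Longrightarrow> is_saturation X \<alpha> (star X \<alpha>)"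
  unfolding star_def using ex_saturation by (rule someI_ex)

lemmas saturated_star = is_saturationD(1)[OF is_saturation_star]
  and le_star = is_saturationD(2)[OF is_saturation_star]
  and star_least = is_saturationD(3)[OF is_saturation_star]

lemma kcomp_sharp_star_le:
  assumes \<alpha>: "\<alpha> \<in> hom X X" and \<beta>: "\<beta> \<in> hom Y Y" and f: "f \<in> X \<rightarrow> Y"
    and base: "hom_le X Y (kcomp X X Y (sharp X Y f) \<alpha>) (kcomp X Y Y \<beta> (sharp X Y f))"
  shows "hom_le X Y (kcomp X X Y (sharp X Y f) (star X \<alpha>)) (kcomp X Y Y (star Y \<beta>) (sharp X Y f))"
proof (rule kcomp_sharp_saturation_le[OF f is_saturation_star[OF \<alpha>] saturated_star[OF \<beta>]])
  note base
  also have "hom_le X Y (kcomp X Y Y \<beta> (sharp X Y f)) (kcomp X Y Y (star Y \<beta>) (sharp X Y f))"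
    by (intro kcomp_hom_le hom_le_refl sharp_in_hom f le_star \<beta>)
  finally show "hom_le X Y (kcomp X X Y (sharp X Y f) \<alpha>) (kcomp X Y Y (star Y \<beta>) (sharp X Y f))" .
qed

lemma star_kcomp_sharp_le:
  assumes \<alpha>: "\<alpha> \<in> hom X X" and \<beta>: "\<beta> \<in> hom Y Y" and f: "f \<in> X \<rightarrow> Y"
    and base: "hom_le X Y (kcomp X Y Y \<beta> (sharp X Y f)) (kcomp X X Y (sharp X Y f) \<alpha>)"
  shows "hom_le X Y (kcomp X Y Y (star Y \<beta>) (sharp X Y f)) (kcomp X X Y (sharp X Y f) (star X \<alpha>))"
proof (rule saturation_kcomp_sharp_le[OF f is_saturation_star[OF \<beta>] saturated_star[OF \<alpha>]])
  note base
  also have "hom_le X Y (kcomp X X Y (sharp X Y f) \<alpha>) (kcomp X X Y (sharp X Y f) (star X \<alpha>))"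
    by (intro kcomp_hom_le hom_le_refl sharp_in_hom f le_star \<alpha>)
  finally show "hom_le X Y (kcomp X Y Y \<beta> (sharp X Y f)) (kcomp X X Y (sharp X Y f) (star X \<alpha>))" .
qed

theorem ordered_saturation_monad: "ordered_saturation_monad T unit ext le"
proof (unfold_locales, rule le_refl, rule le_antisym, rule le_trans, erule (5) kcomp_mono,
    intro exI[of _ star] conjI allI ballI impI)
  fix X \<alpha> assume \<alpha>: "\<alpha> \<in> hom X X"
  note saturatedD[OF saturated_star[OF \<alpha>]]
  then show "star X \<alpha> \<in> hom X X" "le X X (kid X) (star X \<alpha>)"
    "le X X (kcomp X X X (star X \<alpha>) (star X \<alpha>)) (star X \<alpha>)"
    by (simp_all add: hom_le_def)
  show "le X X \<alpha> (star X \<alpha>)"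
    using le_star[OF \<alpha>] by (rule hom_leD(3))
  fix \<beta>
  assume "\<beta> \<in> hom X X" "le X X (kid X) \<beta>" "le X X \<alpha> \<beta>" "le X X (kcomp X X X \<beta> \<beta>) \<beta>"
  then have "saturated X \<beta>" "hom_le X X \<alpha> \<beta>"
    using \<alpha> by (simp_all add: saturated_def hom_le_def kid_in_hom kcomp_in_hom)
  then show "le X X (star X \<alpha>) \<beta>"
    using star_least[OF \<alpha>] hom_leD(3) by blast
next
  fix X Y \<alpha> \<beta> f
  assume maps: "\<alpha> \<in> hom X X" "\<beta> \<in> hom Y Y" "f \<in> X \<rightarrow> Y"
  then have homs: "kcomp X X Y (sharp X Y f) \<alpha> \<in> hom X Y" "kcomp X Y Y \<beta> (sharp X Y f) \<in> hom X Y"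
    by (simp_all add: kcomp_in_hom sharp_in_hom)
  show "le X Y (kcomp X X Y (sharp X Y f) (star X \<alpha>)) (kcomp X Y Y (star Y \<beta>) (sharp X Y f))"
    if "le X Y (kcomp X X Y (sharp X Y f) \<alpha>) (kcomp X Y Y \<beta> (sharp X Y f))"
    using that homs by (intro hom_leD(3)[OF kcomp_sharp_star_le[OF maps]]) (simp add: hom_le_def)
  show "le X Y (kcomp X Y Y (star Y \<beta>) (sharp X Y f)) (kcomp X X Y (sharp X Y f) (star X \<alpha>))"
    if "le X Y (kcomp X Y Y \<beta> (sharp X Y f)) (kcomp X X Y (sharp X Y f) \<alpha>)"
    using that homs by (intro hom_leD(3)[OF star_kcomp_sharp_le[OF maps]]) (simp add: hom_le_def)
qed

end

section \<open>Convex sets of finitely supported weights\<close>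

lemma sum_fun_apply: "(\<Sum>i\<in>I. F i) x = (\<Sum>i\<in>I. F i x)"
  for F :: "'i \<Rightarrow> 'a \<Rightarrow> 'b::comm_monoid_add"
  by (induction I rule: infinite_finite_induct) auto

definition M_bind :: "('i \<Rightarrow> real) \<Rightarrow> ('i \<Rightarrow> 'a \<Rightarrow> real) \<Rightarrow> 'a \<Rightarrow> real" where
  "M_bind \<mu> \<phi> = (\<Sum>i\<in>supp \<mu>. scale (\<mu> i) (\<phi> i))"

lemma M_bind_apply: "M_bind \<mu> \<phi> x = (\<Sum>i\<in>supp \<mu>. \<mu> i * \<phi> i x)"
  by (simp add: M_bind_def sum_fun_apply scale_def)

lemma M_bind_apply_superset:
  "finite I \<Longrightarrow> supp \<mu> \<subseteq> I \<Longrightarrow> M_bind \<mu> \<phi> x = (\<Sum>i\<in>I. \<mu> i * \<phi> i x)"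
  unfolding M_bind_apply by (intro sum.mono_neutral_left) (auto simp: supp_def)

lemma M_bind_cong: "(\<And>i. i \<in> supp \<mu> \<Longrightarrow> \<phi> i = \<psi> i) \<Longrightarrow> M_bind \<mu> \<phi> = M_bind \<mu> \<psi>"
  by (simp add: M_bind_def)

lemma image_Pi_image:
  assumes cong: "\<And>s t. (\<And>x. x \<in> S \<Longrightarrow> s x = t x) \<Longrightarrow> H s = H t"
  shows "H ` (\<Pi> x\<in>S. h x ` G x) = (\<lambda>k. H (\<lambda>x. h x (k x))) ` Pi S G"
proof (intro equalityI image_subsetI)
  fix s assume "s \<in> (\<Pi> x\<in>S. h x ` G x)"
  then have "\<forall>x\<in>S. \<exists>u. u \<in> G x \<and> s x = h x u"
    by auto
  then obtain k where "\<forall>x\<in>S. k x \<in> G x \<and> s x = h x (k x)"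
    by (rule bchoice[THEN exE])
  then have "k \<in> Pi S G" "H s = H (\<lambda>x. h x (k x))"
    by (auto intro: cong)
  then show "H s \<in> (\<lambda>k. H (\<lambda>x. h x (k x))) ` Pi S G"
    by blast
qed auto

lemma sum_scale_image_eq_M_bind_image:
  assumes "finite (supp \<phi>)"
  shows "(\<Sum>x\<in>supp \<phi>. scale (\<phi> x) ` G x) = M_bind \<phi> ` Pi (supp \<phi>) G"
proof -
  have "(\<Sum>x\<in>supp \<phi>. scale (\<phi> x) ` G x)
      = (\<lambda>s. sum s (supp \<phi>)) ` (\<Pi> x\<in>supp \<phi>. scale (\<phi> x) ` G x)"
    using assms by (auto simp: set_sum_alt)
  also have "\<dots> = M_bind \<phi> ` Pi (supp \<phi>) G"
    unfolding M_bind_def by (rule image_Pi_image) (rule sum.cong[OF refl])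
  finally show ?thesis .
qed

lemma supp_zero [simp]: "supp 0 = {}"
  by (simp add: supp_def)

lemma supp_single [simp]: "supp (single x) = {x}"
  by (auto simp: supp_def single_def)

lemma M_bind_zero [simp]: "M_bind 0 \<phi> = 0"
  by (simp add: M_bind_def)

lemma M_bind_single_left [simp]: "M_bind (single x) \<phi> = \<phi> x"
  by (rule ext) (simp add: M_bind_apply, simp add: single_def)

lemma M_bind_single_right:
  assumes "finite (supp \<phi>)"
  shows "M_bind \<phi> single = \<phi>"
proof
  fix x
  have "M_bind \<phi> single x = (\<Sum>i\<in>supp \<phi>. if x = i then \<phi> i else 0)"
    unfolding M_bind_apply by (intro sum.cong) (auto simp: single_def)
  then show "M_bind \<phi> single x = \<phi> x"
    using assms by (simp add: supp_def)
qed

lemma M_memD: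
  assumes "\<phi> \<in> \<M> A"
  shows "0 \<le> \<phi> x" "finite (supp \<phi>)" "supp \<phi> \<subseteq> A"
  using assms by (auto simp: \<M>_def)

lemma zero_in_M: "0 \<in> \<M> A"
  by (simp add: \<M>_def)

lemma single_in_M: "x \<in> A \<Longrightarrow> single x \<in> \<M> A"
  by (simp add: \<M>_def) (simp add: single_def)

lemma M_bind_summand_nonneg:
  assumes "\<mu> \<in> \<M> I" "\<phi> \<in> supp \<mu> \<rightarrow> \<M> A" "i \<in> supp \<mu>"
  shows "0 \<le> \<mu> i * \<phi> i x"
  using assms M_memD(1)[of "\<phi> i" A x] by (intro mult_nonneg_nonneg M_memD(1)[of \<mu>]) auto

lemma supp_M_bind:
  assumes \<mu>: "\<mu> \<in> \<M> I" and \<phi>: "\<phi> \<in> supp \<mu> \<rightarrow> \<M> A"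
  shows "supp (M_bind \<mu> \<phi>) = (\<Union>i\<in>supp \<mu>. supp (\<phi> i))"
proof -
  have "M_bind \<mu> \<phi> x = 0 \<longleftrightarrow> (\<forall>i\<in>supp \<mu>. \<mu> i * \<phi> i x = 0)" for x
    unfolding M_bind_apply
    by (intro sum_nonneg_eq_0_iff M_memD(2)[OF \<mu>] M_bind_summand_nonneg[OF assms])
  then show ?thesis
    by (auto simp: supp_def)
qed

lemma M_bind_in_M:
  assumes \<mu>: "\<mu> \<in> \<M> I" and \<phi>: "\<phi> \<in> supp \<mu> \<rightarrow> \<M> A"
  shows "M_bind \<mu> \<phi> \<in> \<M> A"
proof -
  have "0 \<le> M_bind \<mu> \<phi> x" for x
    unfolding M_bind_apply by (intro sum_nonneg M_bind_summand_nonneg[OF assms])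
  moreover have "finite (supp (M_bind \<mu> \<phi>))" "supp (M_bind \<mu> \<phi>) \<subseteq> A"
    unfolding supp_M_bind[OF assms] using \<phi> M_memD(2)[OF \<mu>] M_memD(2,3)[of _ A] by blast+
  ultimately show ?thesis
    by (simp add: \<M>_def)
qed

definition mass :: "('a \<Rightarrow> real) \<Rightarrow> real" where
  "mass \<mu> = sum \<mu> (supp \<mu>)"

lemma convex_set_M_bind:
  assumes U: "convex_set U" and \<mu>: "\<mu> \<in> \<M> I" "mass \<mu> = 1" and \<phi>: "\<phi> \<in> supp \<mu> \<rightarrow> U"
  shows "M_bind \<mu> \<phi> \<in> U"
proof -
  obtain h where h: "bij_betw h {..<card (supp \<mu>)} (supp \<mu>)"
    using ex_bij_betw_nat_finite[OF M_memD(2)[OF \<mu>(1)]] by (auto simp: atLeast0LessThan)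
  have "0 \<le> \<mu> (h j) \<and> \<phi> (h j) \<in> U" if "j < card (supp \<mu>)" for j
    using that M_memD(1)[OF \<mu>(1)] \<phi> bij_betwE[OF h] by blast
  moreover have "(\<Sum>j<card (supp \<mu>). \<mu> (h j)) = 1"
    using sum.reindex_bij_betw[OF h, of \<mu>] \<mu>(2) by (simp add: mass_def)
  ultimately have "(\<Sum>j<card (supp \<mu>). scale (\<mu> (h j)) (\<phi> (h j))) \<in> U"
    using U[unfolded convex_set_def, rule_format, of _ "\<lambda>j. \<mu> (h j)" "\<lambda>j. \<phi> (h j)"] by blast
  then show ?thesis
    using sum.reindex_bij_betw[OF h, of "\<lambda>i. scale (\<mu> i) (\<phi> i)"] by (simp add: M_bind_def)
qed

lemma convex_setI:
  assumes closed: "\<And>\<mu> \<phi>. \<lbrakk>\<mu> \<in> \<M> (UNIV :: nat set); mass \<mu> = 1; \<phi> \<in> supp \<mu> \<rightarrow> U\<rbrakk> \<Longrightarrow> M_bind \<mu> \<phi> \<in> U"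
  shows "convex_set U"
  unfolding convex_set_def
proof (intro allI impI)
  fix n :: nat and a :: "nat \<Rightarrow> real" and \<phi>
  assume a: "\<forall>i<n. 0 \<le> a i \<and> \<phi> i \<in> U" "(\<Sum>i<n. a i) = 1"
  define \<mu> where "\<mu> i = (if i < n then a i else 0)" for i
  have supp: "supp \<mu> \<subseteq> {..<n}"
    by (auto simp: \<mu>_def supp_def split: if_splits)
  have "mass \<mu> = (\<Sum>i<n. \<mu> i)"
    unfolding mass_def using supp by (intro sum.mono_neutral_left) (auto simp: supp_def)
  moreover have "(\<Sum>i<n. scale (a i) (\<phi> i)) = M_bind \<mu> \<phi>"
    unfolding M_bind_def using supp
    by (intro sum.mono_neutral_cong_right) (auto simp: \<mu>_def supp_def scale_def fun_eq_iff)
  moreover have "\<mu> \<in> \<M> UNIV" "\<phi> \<in> supp \<mu> \<rightarrow> U"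
    using a(1) supp finite_subset[OF supp] by (auto simp: \<M>_def \<mu>_def)
  ultimately show "(\<Sum>i<n. scale (a i) (\<phi> i)) \<in> U"
    using a(2) closed by (simp add: \<mu>_def)
qed

lemma convex_set_singleton: "convex_set {\<phi>}"
proof (rule convex_setI)
  fix \<mu> :: "nat \<Rightarrow> real" and \<psi>
  assume "mass \<mu> = 1" "\<psi> \<in> supp \<mu> \<rightarrow> {\<phi>}"
  then have "M_bind \<mu> \<psi> x = \<phi> x" for x
    by (simp add: M_bind_apply mass_def Pi_iff flip: sum_distrib_right)
  then show "M_bind \<mu> \<psi> \<in> {\<phi>}"
    by auto
qed

lemma convex_set_M: "convex_set (\<M> A)"
  by (rule convex_setI) (rule M_bind_in_M)

lemma convex_set_Inter: "(\<And>U. U \<in> \<U> \<Longrightarrow> convex_set U) \<Longrightarrow> convex_set (\<Inter>\<U>)"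
  unfolding convex_set_def by blast

text \<open>Drawing \<open>i\<close> from \<open>\<mu>\<close> and then \<open>x\<close> from \<open>\<phi> i\<close>, this is the distribution of \<open>i\<close> given \<open>x\<close>
  by Bayes' rule. For \<open>M_bind \<mu> \<phi> x = 0\<close> it is \<open>0\<close>, since \<open>a / 0 = 0\<close>.\<close>

definition posterior :: "('i \<Rightarrow> real) \<Rightarrow> ('i \<Rightarrow> 'a \<Rightarrow> real) \<Rightarrow> 'a \<Rightarrow> 'i \<Rightarrow> real" where
  "posterior \<mu> \<phi> x i = \<mu> i * \<phi> i x / M_bind \<mu> \<phi> x"

lemma supp_posterior: "supp (posterior \<mu> \<phi> x) \<subseteq> {i \<in> supp \<mu>. x \<in> supp (\<phi> i)}"
  by (auto simp: supp_def posterior_def)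

lemma posterior_in_M:
  assumes \<mu>: "\<mu> \<in> \<M> I" and \<phi>: "\<phi> \<in> supp \<mu> \<rightarrow> \<M> A"
  shows "posterior \<mu> \<phi> x \<in> \<M> (supp \<mu>)"
proof -
  have "0 \<le> posterior \<mu> \<phi> x i" for i
  proof (cases "i \<in> supp \<mu>")
    case True
    then show ?thesis
      using M_bind_summand_nonneg[OF \<mu> \<phi>] M_memD(1)[OF M_bind_in_M[OF \<mu> \<phi>]]
      by (simp add: posterior_def)
  qed (simp add: posterior_def supp_def)
  moreover have "supp (posterior \<mu> \<phi> x) \<subseteq> supp \<mu>"
    using supp_posterior by fast
  ultimately show ?thesis
    using finite_subset[OF _ M_memD(2)[OF \<mu>]] by (simp add: \<M>_def)
qed

lemma mass_posterior:
  assumes "finite (supp \<mu>)" "x \<in> supp (M_bind \<mu> \<phi>)"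
  shows "mass (posterior \<mu> \<phi> x) = 1"
proof -
  have "supp (posterior \<mu> \<phi> x) \<subseteq> supp \<mu>"
    using supp_posterior by fast
  then have "mass (posterior \<mu> \<phi> x) = (\<Sum>i\<in>supp \<mu>. posterior \<mu> \<phi> x i)"
    unfolding mass_def using assms(1) by (intro sum.mono_neutral_left) (auto simp: supp_def)
  also have "\<dots> = M_bind \<mu> \<phi> x / M_bind \<mu> \<phi> x"
    by (simp add: posterior_def M_bind_apply flip: sum_divide_distrib)
  finally show ?thesis
    using assms(2) by (simp add: supp_def)
qed

lemma M_bind_posterior:
  assumes \<mu>: "\<mu> \<in> \<M> I" and \<phi>: "\<phi> \<in> supp \<mu> \<rightarrow> \<M> A"
  shows "M_bind (M_bind \<mu> \<phi>) (\<lambda>x. M_bind (posterior \<mu> \<phi> x) (\<lambda>i. \<theta> i x)) =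
    M_bind \<mu> (\<lambda>i. M_bind (\<phi> i) (\<theta> i))" (is "M_bind ?\<Phi> ?\<theta> = _")
proof
  fix y
  have "?\<theta> x y = (\<Sum>i\<in>supp \<mu>. posterior \<mu> \<phi> x i * \<theta> i x y)" for x
    using M_memD(2)[OF \<mu>] M_memD(3)[OF posterior_in_M[OF \<mu> \<phi>]] by (rule M_bind_apply_superset)
  then have "?\<Phi> x * ?\<theta> x y = (\<Sum>i\<in>supp \<mu>. \<mu> i * (\<phi> i x * \<theta> i x y))" if "x \<in> supp ?\<Phi>" for x
    using that by (simp add: supp_def posterior_def sum_distrib_left mult.assoc)
  then have "M_bind ?\<Phi> ?\<theta> y = (\<Sum>x\<in>supp ?\<Phi>. \<Sum>i\<in>supp \<mu>. \<mu> i * (\<phi> i x * \<theta> i x y))"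
    unfolding M_bind_apply[of ?\<Phi>] by (rule sum.cong[OF refl])
  also have "\<dots> = (\<Sum>i\<in>supp \<mu>. \<mu> i * (\<Sum>x\<in>supp ?\<Phi>. \<phi> i x * \<theta> i x y))"
    by (subst sum.swap) (simp add: sum_distrib_left)
  also have "\<dots> = (\<Sum>i\<in>supp \<mu>. \<mu> i * M_bind (\<phi> i) (\<theta> i) y)"
  proof (intro sum.cong refl arg_cong2[of _ _ _ _ "(*)"])
    fix i assume "i \<in> supp \<mu>"
    then have "supp (\<phi> i) \<subseteq> supp ?\<Phi>"
      unfolding supp_M_bind[OF \<mu> \<phi>] by blast
    then show "(\<Sum>x\<in>supp ?\<Phi>. \<phi> i x * \<theta> i x y) = M_bind (\<phi> i) (\<theta> i) y"
      by (rule M_bind_apply_superset[OF M_memD(2)[OF M_bind_in_M[OF \<mu> \<phi>]], symmetric])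
  qed
  finally show "M_bind ?\<Phi> ?\<theta> y = M_bind \<mu> (\<lambda>i. M_bind (\<phi> i) (\<theta> i)) y"
    by (simp add: M_bind_apply)
qed

lemma M_bind_average:
  assumes \<mu>: "\<mu> \<in> \<M> I" and \<phi>: "\<phi> \<in> supp \<mu> \<rightarrow> \<M> A"
    and G: "\<And>x. x \<in> A \<Longrightarrow> convex_set (G x)"
    and \<theta>: "\<And>i. i \<in> supp \<mu> \<Longrightarrow> \<theta> i \<in> Pi (supp (\<phi> i)) G"
  obtains \<theta>' where "\<theta>' \<in> Pi (supp (M_bind \<mu> \<phi>)) G"
    and "M_bind (M_bind \<mu> \<phi>) \<theta>' = M_bind \<mu> (\<lambda>i. M_bind (\<phi> i) (\<theta> i))"
proof
  show "(\<lambda>x. M_bind (posterior \<mu> \<phi> x) (\<lambda>i. \<theta> i x)) \<in> Pi (supp (M_bind \<mu> \<phi>)) G"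
  proof
    fix x assume x: "x \<in> supp (M_bind \<mu> \<phi>)"
    then have "x \<in> A"
      using M_memD(3)[OF M_bind_in_M[OF \<mu> \<phi>]] by blast
    moreover have "(\<lambda>i. \<theta> i x) \<in> supp (posterior \<mu> \<phi> x) \<rightarrow> G x"
      using \<theta> supp_posterior[of \<mu> \<phi> x] by blast
    ultimately show "M_bind (posterior \<mu> \<phi> x) (\<lambda>i. \<theta> i x) \<in> G x"
      by (intro convex_set_M_bind[OF G posterior_in_M[OF \<mu> \<phi>]]
          mass_posterior[OF M_memD(2)[OF \<mu>] x])
  qed
qed (rule M_bind_posterior[OF \<mu> \<phi>])

lemma M_bind_assoc:
  assumes "\<mu> \<in> \<M> I" "\<phi> \<in> supp \<mu> \<rightarrow> \<M> A"
  shows "M_bind (M_bind \<mu> \<phi>) \<theta> = M_bind \<mu> (\<lambda>i. M_bind (\<phi> i) \<theta>)"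
proof -
  obtain \<theta>' where "\<theta>' \<in> Pi (supp (M_bind \<mu> \<phi>)) (\<lambda>x. {\<theta> x})"
    and \<theta>': "M_bind (M_bind \<mu> \<phi>) \<theta>' = M_bind \<mu> (\<lambda>i. M_bind (\<phi> i) \<theta>)"
    using M_bind_average[OF assms, of "\<lambda>x. {\<theta> x}" "\<lambda>_. \<theta>"] convex_set_singleton by blast
  then have "M_bind (M_bind \<mu> \<phi>) \<theta>' = M_bind (M_bind \<mu> \<phi>) \<theta>"
    by (intro M_bind_cong) auto
  with \<theta>' show ?thesis
    by simp
qed

definition CM_bind :: "('a \<Rightarrow> ('b \<Rightarrow> real) set) \<Rightarrow> ('a \<Rightarrow> real) set \<Rightarrow> ('b \<Rightarrow> real) set" where
  "CM_bind G U = (\<Union>\<phi>\<in>U. M_bind \<phi> ` Pi (supp \<phi>) G)"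

lemma CM_memD:
  assumes "U \<in> \<C>\<M> A"
  shows "U \<noteq> {}" "U \<subseteq> \<M> A" "convex_set U"
  using assms by (auto simp: \<C>\<M>_def)

lemma CM_bind_mono:
  assumes "U \<subseteq> V" "U \<subseteq> \<M> A" "\<And>x. x \<in> A \<Longrightarrow> F x \<subseteq> G x"
  shows "CM_bind F U \<subseteq> CM_bind G V"
proof -
  have "Pi (supp \<phi>) F \<subseteq> Pi (supp \<phi>) G" if "\<phi> \<in> U" for \<phi>
    using that assms(2,3) M_memD(3) by (intro Pi_mono) blast
  then show ?thesis
    unfolding CM_bind_def using assms(1) by (intro UN_mono image_mono) auto
qed

lemma CM_bind_cong:
  assumes "U \<subseteq> \<M> A" "\<And>x. x \<in> A \<Longrightarrow> F x = G x"
  shows "CM_bind F U = CM_bind G U"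
  using assms by (intro equalityI CM_bind_mono) auto

lemma CM_bind_single [simp]: "CM_bind G {single x} = G x"
proof -
  have "(\<lambda>_. \<psi>) \<in> Pi {x} G" if "\<psi> \<in> G x" for \<psi>
    using that by simp
  then show ?thesis
    by (force simp: CM_bind_def)
qed

lemma CM_bind_zero [simp]: "CM_bind G {0} = {0}"
  by (auto simp: CM_bind_def)

lemma CM_bind_singletons: "CM_bind (\<lambda>x. {k x}) U = (\<lambda>\<phi>. M_bind \<phi> k) ` U"
proof -
  have "M_bind \<phi> ` Pi (supp \<phi>) (\<lambda>x. {k x}) = {M_bind \<phi> k}" for \<phi>
    by (auto intro!: M_bind_cong)
  then show ?thesis
    by (auto simp: CM_bind_def)
qed

lemma M_bind_in_CM_bind:
  assumes \<mu>: "\<mu> \<in> \<M> I" and F: "\<And>i. i \<in> supp \<mu> \<Longrightarrow> F i \<subseteq> \<M> A"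
    and G: "\<And>x. x \<in> A \<Longrightarrow> convex_set (G x)"
    and \<chi>: "\<chi> \<in> (\<Pi> i\<in>supp \<mu>. CM_bind G (F i))"
  obtains \<phi> where "\<phi> \<in> Pi (supp \<mu>) F" "M_bind \<mu> \<chi> \<in> CM_bind G {M_bind \<mu> \<phi>}"
proof -
  have "\<forall>i\<in>supp \<mu>. \<exists>\<phi> \<theta>. \<phi> \<in> F i \<and> \<theta> \<in> Pi (supp \<phi>) G \<and> \<chi> i = M_bind \<phi> \<theta>"
    using \<chi> by (fastforce simp: CM_bind_def)
  then obtain \<phi> \<theta> where \<phi>: "\<And>i. i \<in> supp \<mu> \<Longrightarrow> \<phi> i \<in> F i"
    and \<theta>: "\<And>i. i \<in> supp \<mu> \<Longrightarrow> \<theta> i \<in> Pi (supp (\<phi> i)) G"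
    and \<chi>_eq: "\<And>i. i \<in> supp \<mu> \<Longrightarrow> \<chi> i = M_bind (\<phi> i) (\<theta> i)"
    by metis
  have "\<phi> \<in> supp \<mu> \<rightarrow> \<M> A"
    using \<phi> F by blast
  from M_bind_average[OF \<mu> this G \<theta>] obtain \<theta>' where "\<theta>' \<in> Pi (supp (M_bind \<mu> \<phi>)) G"
    and "M_bind (M_bind \<mu> \<phi>) \<theta>' = M_bind \<mu> (\<lambda>i. M_bind (\<phi> i) (\<theta> i))" .
  moreover have "\<dots> = M_bind \<mu> \<chi>"
    by (intro M_bind_cong) (simp add: \<chi>_eq)
  ultimately have "M_bind \<mu> \<chi> \<in> CM_bind G {M_bind \<mu> \<phi>}"
    by (force simp: CM_bind_def)
  with that \<phi> show ?thesis
    by blast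
qed

lemma CM_bind_in_CM:
  assumes U: "U \<in> \<C>\<M> A" and G: "\<And>x. x \<in> A \<Longrightarrow> G x \<in> \<C>\<M> B"
  shows "CM_bind G U \<in> \<C>\<M> B"
proof -
  have nonempty: "Pi (supp \<phi>) G \<noteq> {}" and sub: "Pi (supp \<phi>) G \<subseteq> supp \<phi> \<rightarrow> \<M> B" if "\<phi> \<in> U" for \<phi>
    using M_memD(3)[of \<phi> A] CM_memD(2)[OF U] that CM_memD(1,2)[OF G]
    by (auto simp: subset_iff Pi_iff)
  have "CM_bind G U \<noteq> {}"
    using CM_memD(1)[OF U] nonempty by (auto simp: CM_bind_def)
  moreover have "CM_bind G U \<subseteq> \<M> B"
    using M_bind_in_M CM_memD(2)[OF U] sub unfolding CM_bind_def by blast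
  moreover have "convex_set (CM_bind G U)"
  proof (rule convex_setI)
    fix \<mu> :: "nat \<Rightarrow> real" and \<chi>
    assume \<mu>: "\<mu> \<in> \<M> UNIV" "mass \<mu> = 1" and \<chi>: "\<chi> \<in> supp \<mu> \<rightarrow> CM_bind G U"
    obtain \<phi> where \<phi>: "\<phi> \<in> supp \<mu> \<rightarrow> U" "M_bind \<mu> \<chi> \<in> CM_bind G {M_bind \<mu> \<phi>}"
      using M_bind_in_CM_bind[OF \<mu>(1) CM_memD(2)[OF U] CM_memD(3)[OF G] \<chi>] .
    then have "M_bind \<mu> \<phi> \<in> U"
      using convex_set_M_bind[OF CM_memD(3)[OF U] \<mu>] by blast
    then show "M_bind \<mu> \<chi> \<in> CM_bind G U"
      using \<phi>(2) by (auto simp: CM_bind_def)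
  qed
  ultimately show ?thesis
    by (simp add: \<C>\<M>_def)
qed

lemma CM_bind_assoc:
  assumes U: "U \<subseteq> \<M> A" and F: "\<And>x. x \<in> A \<Longrightarrow> F x \<subseteq> \<M> B"
    and G: "\<And>y. y \<in> B \<Longrightarrow> convex_set (G y)"
  shows "CM_bind G (CM_bind F U) = CM_bind (\<lambda>x. CM_bind G (F x)) U"
proof (intro equalityI subsetI)
  fix \<chi> assume "\<chi> \<in> CM_bind G (CM_bind F U)"
  then obtain \<phi> \<psi> \<theta> where \<phi>: "\<phi> \<in> U" and \<psi>: "\<psi> \<in> Pi (supp \<phi>) F"
    and \<theta>: "\<theta> \<in> Pi (supp (M_bind \<phi> \<psi>)) G" and \<chi>: "\<chi> = M_bind (M_bind \<phi> \<psi>) \<theta>"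
    by (auto simp: CM_bind_def)
  have \<phi>M: "\<phi> \<in> \<M> A" and \<psi>M: "\<psi> \<in> supp \<phi> \<rightarrow> \<M> B"
    using \<phi> U \<psi> F M_memD(3)[of \<phi> A] by blast+
  have "\<theta> \<in> Pi (supp (\<psi> x)) G" if "x \<in> supp \<phi>" for x
    using that \<theta> unfolding supp_M_bind[OF \<phi>M \<psi>M] by blast
  then have "(\<lambda>x. M_bind (\<psi> x) \<theta>) \<in> (\<Pi> x\<in>supp \<phi>. CM_bind G (F x))"
    using \<psi> by (auto simp: CM_bind_def)
  then show "\<chi> \<in> CM_bind (\<lambda>x. CM_bind G (F x)) U"
    using \<phi> by (auto simp: CM_bind_def \<chi> M_bind_assoc[OF \<phi>M \<psi>M])
next
  fix \<chi> assume "\<chi> \<in> CM_bind (\<lambda>x. CM_bind G (F x)) U"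
  then obtain \<phi> \<omega> where \<phi>: "\<phi> \<in> U" and \<omega>: "\<omega> \<in> (\<Pi> x\<in>supp \<phi>. CM_bind G (F x))"
    and \<chi>: "\<chi> = M_bind \<phi> \<omega>"
    by (auto simp: CM_bind_def)
  have \<phi>M: "\<phi> \<in> \<M> A"
    using \<phi> U by blast
  then have FM: "F x \<subseteq> \<M> B" if "x \<in> supp \<phi>" for x
    using that F M_memD(3) by blast
  obtain \<psi> where "\<psi> \<in> Pi (supp \<phi>) F" "\<chi> \<in> CM_bind G {M_bind \<phi> \<psi>}"
    unfolding \<chi> using M_bind_in_CM_bind[OF \<phi>M FM G \<omega>] .
  then show "\<chi> \<in> CM_bind G (CM_bind F U)"
    using \<phi> by (auto simp: CM_bind_def)
qed

lemma singleton_in_CM: "\<phi> \<in> \<M> A \<Longrightarrow> {\<phi>} \<in> \<C>\<M> A"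
  by (simp add: \<C>\<M>_def convex_set_singleton)

lemma Inter_in_CM:
  assumes "\<phi> \<in> \<M> A" "\<And>U. U \<in> \<U> \<Longrightarrow> \<phi> \<in> U" "\<And>U. U \<in> \<U> \<Longrightarrow> convex_set U"
  shows "\<M> A \<inter> \<Inter>\<U> \<in> \<C>\<M> A"
proof -
  have "convex_set (\<Inter>(insert (\<M> A) \<U>))"
    using assms(3) convex_set_M by (intro convex_set_Inter) auto
  then show ?thesis
    using assms(1,2) by (auto simp: \<C>\<M>_def)
qed

lemma M_bind_vimage_in_CM:
  assumes V: "convex_set V" and \<phi>: "\<phi> \<in> \<M> A" "M_bind \<phi> k \<in> V"
  shows "{\<phi> \<in> \<M> A. M_bind \<phi> k \<in> V} \<in> \<C>\<M> A"
proof -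
  have "convex_set {\<phi> \<in> \<M> A. M_bind \<phi> k \<in> V}"
  proof (rule convex_setI)
    fix \<mu> :: "nat \<Rightarrow> real" and \<psi>
    assume \<mu>: "\<mu> \<in> \<M> UNIV" "mass \<mu> = 1" and \<psi>: "\<psi> \<in> supp \<mu> \<rightarrow> {\<phi> \<in> \<M> A. M_bind \<phi> k \<in> V}"
    then have \<psi>M: "\<psi> \<in> supp \<mu> \<rightarrow> \<M> A"
      by auto
    have "M_bind \<mu> (\<lambda>i. M_bind (\<psi> i) k) \<in> V"
      using \<psi> by (intro convex_set_M_bind[OF V \<mu>]) auto
    then show "M_bind \<mu> \<psi> \<in> {\<phi> \<in> \<M> A. M_bind \<phi> k \<in> V}"
      using M_bind_in_M[OF \<mu>(1) \<psi>M] by (simp add: M_bind_assoc[OF \<mu>(1) \<psi>M])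
  qed
  then show ?thesis
    using \<phi> by (auto simp: \<C>\<M>_def)
qed

section \<open>The Kleisli triple of labelled convex sets\<close>

lemma rho_None [simp]: "\<rho> None \<psi> = \<psi>"
  by (simp add: \<rho>_def)

lemma rho_Some: "\<rho> (Some s) \<psi> = (\<lambda>(\<sigma>, z). if \<sigma> = Some s then \<psi> (None, z) else 0)"
  by (simp add: \<rho>_def)

lemma rho_single_None [simp]: "\<rho> \<sigma> (single (None, x)) = single (\<sigma>, x)"
  by (cases \<sigma>) (auto simp: rho_Some single_def)

lemma rho_Some_single_Some [simp]: "\<rho> (Some s) (single (Some t, x)) = 0"
  by (auto simp: rho_Some single_def)

lemma rho_Some_rho_Some [simp]: "\<rho> (Some s) (\<rho> (Some t) \<psi>) = 0"
  by (auto simp: rho_Some)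

lemma rho_M_bind: "\<rho> \<sigma> (M_bind \<mu> \<phi>) = M_bind \<mu> (\<lambda>i. \<rho> \<sigma> (\<phi> i))"
proof (cases \<sigma>)
  case (Some s)
  have "\<rho> \<sigma> (M_bind \<mu> \<phi>) q = M_bind \<mu> (\<lambda>i. \<rho> \<sigma> (\<phi> i)) q" for q
    by (cases q) (simp add: Some rho_Some M_bind_apply)
  then show ?thesis ..
qed simp

lemma rho_eq_M_bind: "finite (supp \<psi>) \<Longrightarrow> \<rho> \<sigma> \<psi> = M_bind \<psi> (\<lambda>p. \<rho> \<sigma> (single p))"
  using rho_M_bind[of \<sigma> \<psi> single] by (simp add: M_bind_single_right)

lemma rho_single_in_M: "\<sigma> \<in> L \<Longrightarrow> p \<in> L \<times> Z \<Longrightarrow> \<rho> \<sigma> (single p) \<in> \<M> (L \<times> Z)"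
  by (cases \<sigma>; cases "fst p"; cases p) (auto intro: single_in_M zero_in_M)

lemma rho_image_eq_CM_bind: "V \<subseteq> \<M> A \<Longrightarrow> \<rho> \<sigma> ` V = CM_bind (\<lambda>p. {\<rho> \<sigma> (single p)}) V"
  unfolding CM_bind_singletons using M_memD(2) by (intro image_cong refl rho_eq_M_bind) blast

lemma rho_image_CM_bind: "\<rho> \<sigma> ` CM_bind G U = CM_bind (\<lambda>x. \<rho> \<sigma> ` G x) U"
proof -
  have "\<rho> \<sigma> ` M_bind \<phi> ` Pi (supp \<phi>) G = M_bind \<phi> ` Pi (supp \<phi>) (\<lambda>x. \<rho> \<sigma> ` G x)" for \<phi>
  proof -
    have "\<rho> \<sigma> ` M_bind \<phi> ` Pi (supp \<phi>) G = (\<lambda>k. M_bind \<phi> (\<lambda>x. \<rho> \<sigma> (k x))) ` Pi (supp \<phi>) G"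
      by (simp add: image_image rho_M_bind)
    also have "\<dots> = M_bind \<phi> ` Pi (supp \<phi>) (\<lambda>x. \<rho> \<sigma> ` G x)"
      by (rule image_Pi_image[OF M_bind_cong, symmetric])
    finally show ?thesis .
  qed
  then show ?thesis
    by (simp add: CM_bind_def image_UN)
qed

definition relabel :: "('y \<Rightarrow> ('s option \<times> 'z \<Rightarrow> real) set) \<Rightarrow> 's option \<times> 'y \<Rightarrow>
    ('s option \<times> 'z \<Rightarrow> real) set" where
  "relabel g = (\<lambda>(\<sigma>, y). \<rho> \<sigma> ` g y)"

lemma relabel_in_CM:
  assumes g: "\<And>y. y \<in> Y \<Longrightarrow> g y \<in> \<C>\<M> (L \<times> Z)" and p: "p \<in> L \<times> Y"
  shows "relabel g p \<in> \<C>\<M> (L \<times> Z)"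
proof -
  obtain \<sigma> y where \<sigma>y: "p = (\<sigma>, y)" "\<sigma> \<in> L" "y \<in> Y"
    using p by blast
  note gy = g[OF \<sigma>y(3)]
  have "CM_bind (\<lambda>q. {\<rho> \<sigma> (single q)}) (g y) \<in> \<C>\<M> (L \<times> Z)"
    by (intro CM_bind_in_CM[OF gy] singleton_in_CM rho_single_in_M \<sigma>y)
  then show ?thesis
    by (simp add: \<sigma>y relabel_def rho_image_eq_CM_bind[OF CM_memD(2)[OF gy]])
qed

text \<open>\<open>\<rho> \<sigma>\<close> is itself a bind, so by associativity the claim reduces to point masses.
  At a point with a visible label, both sides are \<open>{0}\<close> if \<open>\<sigma>\<close> is visible too.\<close>

lemma CM_bind_relabel_rho_image:
  assumes V: "V \<subseteq> \<M> (L \<times> Y)" and g: "\<And>y. y \<in> Y \<Longrightarrow> g y \<in> \<C>\<M> (L \<times> Z)" and \<sigma>: "\<sigma> \<in> L"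
  shows "CM_bind (relabel g) (\<rho> \<sigma> ` V) = \<rho> \<sigma> ` CM_bind (relabel g) V"
proof -
  have point_mass: "CM_bind (relabel g) {\<rho> \<sigma> (single p)} = \<rho> \<sigma> ` relabel g p"
    if p_in: "p \<in> L \<times> Y" for p
  proof (cases \<sigma>)
    case (Some s)
    obtain \<sigma>' y where p: "p = (\<sigma>', y)" "y \<in> Y"
      using p_in by blast
    with CM_memD(1)[OF g] show ?thesis
      by (cases \<sigma>') (auto simp: Some relabel_def image_image)
  qed simp
  have "CM_bind (relabel g) (\<rho> \<sigma> ` V) = CM_bind (relabel g) (CM_bind (\<lambda>p. {\<rho> \<sigma> (single p)}) V)"
    by (simp add: rho_image_eq_CM_bind[OF V])
  also have "\<dots> = CM_bind (\<lambda>p. CM_bind (relabel g) {\<rho> \<sigma> (single p)}) V"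
    using V
  proof (rule CM_bind_assoc)
    show "{\<rho> \<sigma> (single p)} \<subseteq> \<M> (L \<times> Y)" if "p \<in> L \<times> Y" for p
      using rho_single_in_M[OF \<sigma> that] by simp
    show "convex_set (relabel g q)" if "q \<in> L \<times> Y" for q
      by (rule CM_memD(3)[OF relabel_in_CM[OF g that]])
  qed
  also have "\<dots> = CM_bind (\<lambda>p. \<rho> \<sigma> ` relabel g p) V"
    using V point_mass by (rule CM_bind_cong)
  finally show ?thesis
    by (simp only: rho_image_CM_bind)
qed

lemma cm_ext_eq_CM_bind:
  assumes "U \<subseteq> \<M> A"
  shows "cm_ext g U = CM_bind (relabel g) U"
proof -
  have "(\<Sum>(\<sigma>, y)\<in>supp \<phi>. {scale (\<phi> (\<sigma>, y)) (\<rho> \<sigma> \<psi>) | \<psi>. \<psi> \<in> g y})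
      = M_bind \<phi> ` Pi (supp \<phi>) (relabel g)" if "\<phi> \<in> U" for \<phi>
  proof -
    have "(\<Sum>(\<sigma>, y)\<in>supp \<phi>. {scale (\<phi> (\<sigma>, y)) (\<rho> \<sigma> \<psi>) | \<psi>. \<psi> \<in> g y})
        = (\<Sum>p\<in>supp \<phi>. scale (\<phi> p) ` relabel g p)"
      by (intro sum.cong) (auto simp: relabel_def)
    also have "\<dots> = M_bind \<phi> ` Pi (supp \<phi>) (relabel g)"
      using that assms M_memD(2) by (intro sum_scale_image_eq_M_bind_image) blast
    finally show ?thesis .
  qed
  then show ?thesis
    unfolding cm_ext_def CM_bind_def by simp
qed

lemma cm_ext_mono:
  assumes "U \<subseteq> V" "V \<subseteq> \<M> (L \<times> Y)" "\<And>y. y \<in> Y \<Longrightarrow> g y \<subseteq> h y"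
  shows "cm_ext g U \<subseteq> cm_ext h V"
proof -
  have U: "U \<subseteq> \<M> (L \<times> Y)"
    using assms(1,2) by blast
  have "relabel g p \<subseteq> relabel h p" if "p \<in> L \<times> Y" for p
    using that assms(3) by (auto simp: relabel_def)
  then show ?thesis
    unfolding cm_ext_eq_CM_bind[OF U] cm_ext_eq_CM_bind[OF assms(2)]
    by (rule CM_bind_mono[OF assms(1) U])
qed

lemma cm_ext_in_CM:
  assumes g: "\<And>y. y \<in> Y \<Longrightarrow> g y \<in> \<C>\<M> (L \<times> Z)" and U: "U \<in> \<C>\<M> (L \<times> Y)"
  shows "cm_ext g U \<in> \<C>\<M> (L \<times> Z)"
  unfolding cm_ext_eq_CM_bind[OF CM_memD(2)[OF U]]
  using U relabel_in_CM[OF g] by (rule CM_bind_in_CM)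

lemma cm_ext_assoc:
  assumes f: "\<And>x. x \<in> X \<Longrightarrow> f x \<in> \<C>\<M> (L \<times> Y)" and g: "\<And>y. y \<in> Y \<Longrightarrow> g y \<in> \<C>\<M> (L \<times> Z)"
    and U: "U \<in> \<C>\<M> (L \<times> X)"
  shows "cm_ext g (cm_ext f U) = cm_ext (\<lambda>x\<in>X. cm_ext g (f x)) U"
proof -
  note U_M = CM_memD(2)[OF U]
  have "cm_ext g (cm_ext f U) = CM_bind (relabel g) (cm_ext f U)"
    by (rule cm_ext_eq_CM_bind[OF CM_memD(2)[OF cm_ext_in_CM[OF f U]]])
  also have "\<dots> = CM_bind (relabel g) (CM_bind (relabel f) U)"
    by (simp only: cm_ext_eq_CM_bind[OF U_M])
  also have "\<dots> = CM_bind (\<lambda>p. CM_bind (relabel g) (relabel f p)) U"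
    by (rule CM_bind_assoc[OF U_M CM_memD(2)[OF relabel_in_CM[OF f]]
          CM_memD(3)[OF relabel_in_CM[OF g]]])
  also have "\<dots> = CM_bind (relabel (\<lambda>x\<in>X. cm_ext g (f x))) U"
  proof (rule CM_bind_cong[OF U_M])
    fix p assume "p \<in> L \<times> X"
    then obtain \<sigma> x where p: "p = (\<sigma>, x)" "\<sigma> \<in> L" "x \<in> X"
      by blast
    note fx_M = CM_memD(2)[OF f[OF p(3)]]
    show "CM_bind (relabel g) (relabel f p) = relabel (\<lambda>x\<in>X. cm_ext g (f x)) p"
      using CM_bind_relabel_rho_image[OF fx_M g p(2)] p
      by (simp add: relabel_def cm_ext_eq_CM_bind[OF fx_M])
  qed
  also have "\<dots> = cm_ext (\<lambda>x\<in>X. cm_ext g (f x)) U"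
    by (rule cm_ext_eq_CM_bind[OF U_M, symmetric])
  finally show ?thesis .
qed

lemma cm_unit_in_CM: "x \<in> X \<Longrightarrow> cm_unit x \<in> \<C>\<M> (labels \<Sigma> \<times> X)"
  by (simp add: cm_unit_def labels_def singleton_in_CM single_in_M)

lemma cm_ext_cm_unit: "cm_ext g (cm_unit x) = g x"
proof -
  have "cm_ext g (cm_unit x) = CM_bind (relabel g) (cm_unit x)"
    by (rule cm_ext_eq_CM_bind[of _ UNIV]) (simp add: cm_unit_def single_in_M)
  also have "\<dots> = g x"
    by (simp add: cm_unit_def relabel_def)
  finally show ?thesis .
qed

definition M_map :: "('a \<Rightarrow> 'b) \<Rightarrow> ('a \<Rightarrow> real) \<Rightarrow> 'b \<Rightarrow> real" where
  "M_map h \<phi> = M_bind \<phi> (\<lambda>x. single (h x))"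

lemma cm_ext_sharp:
  assumes "U \<subseteq> \<M> (L \<times> X)"
  shows "cm_ext (\<lambda>x\<in>X. cm_unit (f x)) U = M_map (map_prod id f) ` U"
proof -
  have "cm_ext (\<lambda>x\<in>X. cm_unit (f x)) U = CM_bind (relabel (\<lambda>x\<in>X. cm_unit (f x))) U"
    using assms by (rule cm_ext_eq_CM_bind)
  also have "\<dots> = CM_bind (\<lambda>p. {single (map_prod id f p)}) U"
    using assms by (rule CM_bind_cong) (auto simp: relabel_def cm_unit_def)
  finally show ?thesis
    by (simp add: CM_bind_singletons M_map_def)
qed

lemma cm_ext_kid:
  assumes "U \<subseteq> \<M> (L \<times> X)"
  shows "cm_ext (\<lambda>x\<in>X. cm_unit x) U = U"
proof -
  have "M_map (map_prod id id) \<phi> = \<phi>" if "\<phi> \<in> U" for \<phi>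
    using that assms M_memD(2) by (auto simp: M_map_def prod.map_id0 intro!: M_bind_single_right)
  then show ?thesis
    using cm_ext_sharp[OF assms, of id] by simp
qed

interpretation CM: kleisli_triple
  "\<lambda>X :: 'u set. \<C>\<M> (labels \<Sigma> \<times> X)" "\<lambda>X. cm_unit" "\<lambda>X Y. cm_ext"
  for \<Sigma> :: "'s set"
proof
  fix X Y Z :: "'u set" and f g :: "'u \<Rightarrow> ('s option \<times> 'u \<Rightarrow> real) set"
    and U :: "('s option \<times> 'u \<Rightarrow> real) set" and x
  show "x \<in> X \<Longrightarrow> cm_unit x \<in> \<C>\<M> (labels \<Sigma> \<times> X)"
    by (rule cm_unit_in_CM)
  show "cm_ext f (cm_unit x) = f x"
    by (rule cm_ext_cm_unit)
  assume U: "U \<in> \<C>\<M> (labels \<Sigma> \<times> X)"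
  show "cm_ext (\<lambda>x\<in>X. cm_unit x) U = U"
    by (rule cm_ext_kid[OF CM_memD(2)[OF U]])
  assume f: "f \<in> X \<rightarrow>\<^sub>E \<C>\<M> (labels \<Sigma> \<times> Y)"
  show "cm_ext f U \<in> \<C>\<M> (labels \<Sigma> \<times> Y)"
    by (rule cm_ext_in_CM[OF PiE_mem[OF f] U])
  assume g: "g \<in> Y \<rightarrow>\<^sub>E \<C>\<M> (labels \<Sigma> \<times> Z)"
  show "cm_ext g (cm_ext f U) = cm_ext (\<lambda>x\<in>X. cm_ext g (f x)) U"
    by (rule cm_ext_assoc[OF PiE_mem[OF f] PiE_mem[OF g] U])
qed

lemma CM_hom_apply: "f \<in> CM.hom \<Sigma> X Y \<Longrightarrow> x \<in> X \<Longrightarrow> f x \<in> \<C>\<M> (labels \<Sigma> \<times> Y)"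
  unfolding CM.hom_def by (rule PiE_mem)

lemma restrict_in_CM_hom:
  "(\<And>x. x \<in> X \<Longrightarrow> f x \<in> \<C>\<M> (labels \<Sigma> \<times> Y)) \<Longrightarrow> restrict f X \<in> CM.hom \<Sigma> X Y"
  by (simp add: CM.hom_def)

lemma CM_kcomp_sharp_left_apply:
  assumes "\<alpha> \<in> CM.hom \<Sigma> X Y" "x \<in> X"
  shows "CM.kcomp X Y Z (CM.sharp Y Z f) \<alpha> x = M_map (map_prod id f) ` \<alpha> x"
  using assms(2) cm_ext_sharp[OF CM_memD(2)[OF CM_hom_apply[OF assms]], of f]
  by (simp add: CM.kcomp_def CM.sharp_def)

section \<open>The pointwise order and its residuals\<close>

interpretation CM: ordered_kleisli_triple
  "\<lambda>X :: 'u set. \<C>\<M> (labels \<Sigma> \<times> X)" "\<lambda>X. cm_unit" "\<lambda>X Y. cm_ext" "\<lambda>X Y f g. \<forall>x\<in>X. f x \<subseteq> g x"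
  for \<Sigma> :: "'s set"
proof
  fix X Y Z :: "'u set"
  show "reflp_on (CM.hom \<Sigma> X Y) (\<lambda>f g. \<forall>x\<in>X. f x \<subseteq> g x)"
    by (simp add: reflp_on_def)
  show "antisymp_on (CM.hom \<Sigma> X Y) (\<lambda>f g. \<forall>x\<in>X. f x \<subseteq> g x)"
    unfolding antisymp_on_def CM.hom_def by (meson PiE_ext subset_antisym)
  show "transp_on (CM.hom \<Sigma> X Y) (\<lambda>f g. \<forall>x\<in>X. f x \<subseteq> g x)"
    unfolding transp_on_def by blast
  fix f f' g g' :: "'u \<Rightarrow> ('s option \<times> 'u \<Rightarrow> real) set"
  assume "f' \<in> CM.hom \<Sigma> X Y" "\<forall>x\<in>X. f x \<subseteq> f' x" "\<forall>y\<in>Y. g y \<subseteq> g' y"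
  then have "cm_ext g (f x) \<subseteq> cm_ext g' (f' x)" if "x \<in> X" for x
    using that by (intro cm_ext_mono[OF _ CM_memD(2)[OF CM_hom_apply]]) auto
  then show "\<forall>x\<in>X. CM.kcomp X Y Z g f x \<subseteq> CM.kcomp X Y Z g' f' x"
    by (simp add: CM.kcomp_def)
qed

lemma CM_ex_infimum:
  assumes B: "B \<subseteq> CM.hom \<Sigma> X Y" and \<kappa>: "\<kappa> \<in> CM.hom \<Sigma> X Y" "\<And>\<beta>. \<beta> \<in> B \<Longrightarrow> \<forall>x\<in>X. \<kappa> x \<subseteq> \<beta> x"
  shows "\<exists>\<mu>\<in>CM.hom \<Sigma> X Y. \<forall>\<gamma>\<in>CM.hom \<Sigma> X Y.
    (\<forall>x\<in>X. \<gamma> x \<subseteq> \<mu> x) \<longleftrightarrow> (\<forall>\<beta>\<in>B. \<forall>x\<in>X. \<gamma> x \<subseteq> \<beta> x)"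
proof
  let ?\<mu> = "\<lambda>x\<in>X. \<M> (labels \<Sigma> \<times> Y) \<inter> (\<Inter>\<beta>\<in>B. \<beta> x)"
  show "?\<mu> \<in> CM.hom \<Sigma> X Y"
  proof (rule restrict_in_CM_hom)
    fix x assume x: "x \<in> X"
    obtain \<phi> where \<phi>: "\<phi> \<in> \<kappa> x" "\<phi> \<in> \<M> (labels \<Sigma> \<times> Y)"
      using CM_memD(1,2)[OF CM_hom_apply[OF \<kappa>(1) x]] by blast
    show "\<M> (labels \<Sigma> \<times> Y) \<inter> (\<Inter>\<beta>\<in>B. \<beta> x) \<in> \<C>\<M> (labels \<Sigma> \<times> Y)"
    proof (rule Inter_in_CM[OF \<phi>(2)])
      fix U assume "U \<in> (\<lambda>\<beta>. \<beta> x) ` B"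
      then obtain \<beta> where \<beta>: "\<beta> \<in> B" "\<beta> \<in> CM.hom \<Sigma> X Y" "U = \<beta> x"
        using B by blast
      show "\<phi> \<in> U"
        using \<kappa>(2)[OF \<beta>(1)] x \<phi>(1) \<beta>(3) by blast
      show "convex_set U"
        unfolding \<beta>(3) by (rule CM_memD(3)[OF CM_hom_apply[OF \<beta>(2) x]])
    qed
  qed
  show "\<forall>\<gamma>\<in>CM.hom \<Sigma> X Y. (\<forall>x\<in>X. \<gamma> x \<subseteq> ?\<mu> x) \<longleftrightarrow> (\<forall>\<beta>\<in>B. \<forall>x\<in>X. \<gamma> x \<subseteq> \<beta> x)"
  proof
    fix \<gamma> assume \<gamma>: "\<gamma> \<in> CM.hom \<Sigma> X Y"
    have "\<gamma> x \<subseteq> ?\<mu> x \<longleftrightarrow> (\<forall>\<beta>\<in>B. \<gamma> x \<subseteq> \<beta> x)" if "x \<in> X" for x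
      using that CM_memD(2)[OF CM_hom_apply[OF \<gamma> that]] by auto
    then have "(\<forall>x\<in>X. \<gamma> x \<subseteq> ?\<mu> x) \<longleftrightarrow> (\<forall>x\<in>X. \<forall>\<beta>\<in>B. \<gamma> x \<subseteq> \<beta> x)"
      by (rule ball_cong[OF refl])
    then show "(\<forall>x\<in>X. \<gamma> x \<subseteq> ?\<mu> x) \<longleftrightarrow> (\<forall>\<beta>\<in>B. \<forall>x\<in>X. \<gamma> x \<subseteq> \<beta> x)"
      by blast
  qed
qed

lemma CM_ex_sharp_post_residual:
  assumes f: "f \<in> X \<rightarrow> Y" and \<eta>: "\<eta> \<in> CM.hom \<Sigma> X Y" "\<forall>x\<in>X. CM.sharp X Y f x \<subseteq> \<eta> x"
  shows "\<exists>\<gamma>\<in>CM.hom \<Sigma> X X. \<forall>\<alpha>\<in>CM.hom \<Sigma> X X.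
    (\<forall>x\<in>X. \<alpha> x \<subseteq> \<gamma> x) \<longleftrightarrow> (\<forall>x\<in>X. CM.kcomp X X Y (CM.sharp X Y f) \<alpha> x \<subseteq> \<eta> x)"
proof
  let ?\<gamma> = "\<lambda>x\<in>X. {\<phi> \<in> \<M> (labels \<Sigma> \<times> X). M_map (map_prod id f) \<phi> \<in> \<eta> x}"
  show "?\<gamma> \<in> CM.hom \<Sigma> X X"
  proof (rule restrict_in_CM_hom)
    fix x assume x: "x \<in> X"
    then have "single (None, x) \<in> \<M> (labels \<Sigma> \<times> X)" "single (None, f x) \<in> \<eta> x"
      using \<eta>(2) by (auto simp: labels_def CM.sharp_def cm_unit_def intro: single_in_M)
    then show "{\<phi> \<in> \<M> (labels \<Sigma> \<times> X). M_map (map_prod id f) \<phi> \<in> \<eta> x} \<in> \<C>\<M> (labels \<Sigma> \<times> X)"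
      unfolding M_map_def using CM_memD(3)[OF CM_hom_apply[OF \<eta>(1) x]]
      by (intro M_bind_vimage_in_CM[of _ "single (None, x)"]) simp_all
  qed
  show "\<forall>\<alpha>\<in>CM.hom \<Sigma> X X. (\<forall>x\<in>X. \<alpha> x \<subseteq> ?\<gamma> x) \<longleftrightarrow>
      (\<forall>x\<in>X. CM.kcomp X X Y (CM.sharp X Y f) \<alpha> x \<subseteq> \<eta> x)"
  proof
    fix \<alpha> assume \<alpha>: "\<alpha> \<in> CM.hom \<Sigma> X X"
    have "\<alpha> x \<subseteq> ?\<gamma> x \<longleftrightarrow> CM.kcomp X X Y (CM.sharp X Y f) \<alpha> x \<subseteq> \<eta> x" if "x \<in> X" for x
      unfolding CM_kcomp_sharp_left_apply[OF \<alpha> that]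
      using that CM_memD(2)[OF CM_hom_apply[OF \<alpha> that]] by auto
    then show "(\<forall>x\<in>X. \<alpha> x \<subseteq> ?\<gamma> x) \<longleftrightarrow> (\<forall>x\<in>X. CM.kcomp X X Y (CM.sharp X Y f) \<alpha> x \<subseteq> \<eta> x)"
      by (rule ball_cong[OF refl])
  qed
qed

lemma CM_ex_sharp_pre_residual:
  assumes f: "f \<in> X \<rightarrow> Y" and \<eta>: "\<eta> \<in> CM.hom \<Sigma> X Y" "\<forall>x\<in>X. CM.sharp X Y f x \<subseteq> \<eta> x"
  shows "\<exists>\<delta>\<in>CM.hom \<Sigma> Y Y. \<forall>\<beta>\<in>CM.hom \<Sigma> Y Y.
    (\<forall>y\<in>Y. \<beta> y \<subseteq> \<delta> y) \<longleftrightarrow> (\<forall>x\<in>X. CM.kcomp X Y Y \<beta> (CM.sharp X Y f) x \<subseteq> \<eta> x)"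
proof
  let ?\<delta> = "\<lambda>y\<in>Y. \<M> (labels \<Sigma> \<times> Y) \<inter> \<Inter>(\<eta> ` {x \<in> X. f x = y})"
  show "?\<delta> \<in> CM.hom \<Sigma> Y Y"
  proof (rule restrict_in_CM_hom, rule Inter_in_CM)
    fix y U assume "y \<in> Y"
    then show "single (None, y) \<in> \<M> (labels \<Sigma> \<times> Y)"
      by (simp add: labels_def single_in_M)
    assume "U \<in> \<eta> ` {x \<in> X. f x = y}"
    then obtain x where x: "x \<in> X" "f x = y" "U = \<eta> x"
      by blast
    show "single (None, y) \<in> U"
      using x \<eta>(2) by (auto simp: CM.sharp_def cm_unit_def)
    show "convex_set U"
      unfolding x(3) by (rule CM_memD(3)[OF CM_hom_apply[OF \<eta>(1) x(1)]])
  qed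
  show "\<forall>\<beta>\<in>CM.hom \<Sigma> Y Y. (\<forall>y\<in>Y. \<beta> y \<subseteq> ?\<delta> y) \<longleftrightarrow>
      (\<forall>x\<in>X. CM.kcomp X Y Y \<beta> (CM.sharp X Y f) x \<subseteq> \<eta> x)"
  proof
    fix \<beta> assume \<beta>: "\<beta> \<in> CM.hom \<Sigma> Y Y"
    have "\<beta> y \<subseteq> ?\<delta> y \<longleftrightarrow> (\<forall>x\<in>X. f x = y \<longrightarrow> \<beta> y \<subseteq> \<eta> x)" if "y \<in> Y" for y
      using that CM_memD(2)[OF CM_hom_apply[OF \<beta> that]] by auto
    then have "(\<forall>y\<in>Y. \<beta> y \<subseteq> ?\<delta> y) \<longleftrightarrow> (\<forall>y\<in>Y. \<forall>x\<in>X. f x = y \<longrightarrow> \<beta> y \<subseteq> \<eta> x)"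
      by (rule ball_cong[OF refl])
    also have "\<dots> \<longleftrightarrow> (\<forall>x\<in>X. \<beta> (f x) \<subseteq> \<eta> x)"
      using f by auto
    also have "\<dots> \<longleftrightarrow> (\<forall>x\<in>X. CM.kcomp X Y Y \<beta> (CM.sharp X Y f) x \<subseteq> \<eta> x)"
      by (simp add: CM.kcomp_sharp_apply[OF \<beta> f])
    finally show "(\<forall>y\<in>Y. \<beta> y \<subseteq> ?\<delta> y) \<longleftrightarrow>
        (\<forall>x\<in>X. CM.kcomp X Y Y \<beta> (CM.sharp X Y f) x \<subseteq> \<eta> x)" .
  qed
qed

theorem theorem8p10:
  fixes \<Sigma> :: "'s set"
  shows "ordered_saturation_monad
    (\<lambda>X :: 'u set. \<C>\<M> (labels \<Sigma> \<times> X))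
    (\<lambda>X. cm_unit)
    (\<lambda>X Y. cm_ext)
    (\<lambda>X Y f g. \<forall>x\<in>X. f x \<subseteq> g x)"
proof -
  interpret residuated_kleisli_triple
    "\<lambda>X :: 'u set. \<C>\<M> (labels \<Sigma> \<times> X)" "\<lambda>X. cm_unit" "\<lambda>X Y. cm_ext"
    "\<lambda>X Y f g. \<forall>x\<in>X. f x \<subseteq> g x"
    by unfold_locales
      (rule CM_ex_infimum CM_ex_sharp_post_residual CM_ex_sharp_pre_residual; assumption)+
  show ?thesis
    by (rule ordered_saturation_monad)
qed

end
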